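(* For any integer $n\ge 2$, there exist a metric $d$ on $\mathbb R^n$, inducing the Euclidean topology, such that $(\mathbb R^n,d)$ is a straight G-space, and a dense subset $S\subset\mathbb R^n$ such that for any $p\in S$ and any $\epsilon>0$, the closed $d$-ball $\bar B(p,\epsilon)$ is not stably starlike at $p$.
   Context: A shortest path in a metric space is an isometric embedding of a (compact, nondegenerate) interval. A metric space is a geodesic space if any two points are joined by a shortest path. A G-space is a complete, locally compact geodesic space with the local unique extension property: every point has a neighborhood $U$ such that any shortest path in $U$ admits a unique maximal extension (as a shortest path) reaching the boundary $\partial U$. (This is equivalent to Busemann's original axioms: $(X,d)$ is a metric space in which bounded closed sets are compact; any two distinct points $x,z$ have a point $y\ne x,z$ with $d(x,y)+d(y,z)=d(x,z)$; every point $p$ has $\rho>0$ such that for any distinct $x,y\in B(p,\rho)$ there is $z\neq y$ with $d(x,y)+d(y,z)=d(x,z)$; and if $x\ne y$, $d(x,y)+d(y,z_k)=d(x,z_k)$ for $k=1,2$ and $d(y,z_1)=d(y,z_2)$, then $z_1=z_2$.) A G-space is straight if every shortest path is extendable to a line, i.e. to an isometric embedding of $\mathbb R$. Let $X$ be a geodesic space and $A\subset X$, with topological interior $\operatorname{Int}A$ and boundary $\partial A$. $A$ is starlike with respect to $p\in\operatorname{Int}A$ if every $x\in A\setminus\{p\}$ lies on a unique shortest path contained in $A$ from $p$ to some point of $\partial A$. $A$ is stably starlike at $p\in\operatorname{Int}A$ if there exists $\delta>0$ such that $A$ is starlike with respect to every $x$ in the open ball $B(p,\delta)$. *)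

theory Defs
  imports "HOL-Analysis.Analysis"
begin

(* Paths are extensional functions on their interval of definition, so that equality of
   paths, and hence the unique existence of paths, is not affected by junk values. *)

context Metric_space
begin

definition shortest_path :: "real \<Rightarrow> real \<Rightarrow> (real \<Rightarrow> 'a) \<Rightarrow> bool" where
  "shortest_path a b \<gamma> \<longleftrightarrow>
     a < b \<and> \<gamma> \<in> {a..b} \<rightarrow>\<^sub>E M \<and> (\<forall>s\<in>{a..b}. \<forall>t\<in>{a..b}. d (\<gamma> s) (\<gamma> t) = \<bar>s - t\<bar>)"

definition metric_line :: "(real \<Rightarrow> 'a) \<Rightarrow> bool" where
  "metric_line g \<longleftrightarrow> range g \<subseteq> M \<and> (\<forall>s t. d (g s) (g t) = \<bar>s - t\<bar>)"

(* Only distinct points need a shortest path, since shortest paths are nondegenerate. *)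
definition geodesic_space :: bool where
  "geodesic_space \<longleftrightarrow>
     (\<forall>x\<in>M. \<forall>y\<in>M. x \<noteq> y \<longrightarrow> (\<exists>a b \<gamma>. shortest_path a b \<gamma> \<and> \<gamma> a = x \<and> \<gamma> b = y))"

definition extension_in ::
  "'a set \<Rightarrow> real \<times> real \<times> (real \<Rightarrow> 'a) \<Rightarrow> real \<times> real \<times> (real \<Rightarrow> 'a) \<Rightarrow> bool" where
  "extension_in C = (\<lambda>(a, b, \<gamma>) (a', b', \<sigma>).
     shortest_path a' b' \<sigma> \<and> \<sigma> ` {a'..b'} \<subseteq> C \<and>
     a' \<le> a \<and> b \<le> b' \<and> restrict \<sigma> {a..b} = \<gamma>)"

definition maximal_extension_in ::
  "'a set \<Rightarrow> real \<times> real \<times> (real \<Rightarrow> 'a) \<Rightarrow> real \<times> real \<times> (real \<Rightarrow> 'a) \<Rightarrow> bool" where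
  "maximal_extension_in C c e \<longleftrightarrow>
     extension_in C c e \<and> (\<forall>e'. extension_in C e e' \<longrightarrow> e' = e)"

(* Maximality is understood among the shortest paths in the closure of U, and both ends of
   the maximal extension have to reach the boundary of U (with only one end required, a
   closed half-line would qualify, contrary to Busemann's axioms). *)
definition local_unique_extension :: bool where
  "local_unique_extension \<longleftrightarrow>
     (\<forall>p\<in>M. \<exists>U\<subseteq>M. p \<in> mtopology interior_of U \<and>
        (\<forall>a b \<gamma>. shortest_path a b \<gamma> \<and> \<gamma> ` {a..b} \<subseteq> U \<longrightarrow>
           (\<exists>!e. maximal_extension_in (mtopology closure_of U) (a, b, \<gamma>) e) \<and>
           (\<forall>a' b' \<sigma>. maximal_extension_in (mtopology closure_of U) (a, b, \<gamma>) (a', b', \<sigma>) \<longrightarrow>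
              \<sigma> a' \<in> mtopology frontier_of U \<and> \<sigma> b' \<in> mtopology frontier_of U)))"

definition G_space :: bool where
  "G_space \<longleftrightarrow>
     mcomplete \<and> locally_compact_space mtopology \<and> geodesic_space \<and> local_unique_extension"

definition straight_G_space :: bool where
  "straight_G_space \<longleftrightarrow> G_space \<and>
     (\<forall>a b \<gamma>. shortest_path a b \<gamma> \<longrightarrow> (\<exists>g. metric_line g \<and> restrict g {a..b} = \<gamma>))"

(* The interval of a path issuing from p is normalised to {0..L}: a translation of the
   parameter does not count as a different path. *)
definition starlike_wrt :: "'a set \<Rightarrow> 'a \<Rightarrow> bool" where
  "starlike_wrt A p \<longleftrightarrow> p \<in> mtopology interior_of A \<and>
     (\<forall>x\<in>A - {p}. \<exists>!(L, \<sigma>). shortest_path 0 L \<sigma> \<and> \<sigma> ` {0..L} \<subseteq> A \<and>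
        \<sigma> 0 = p \<and> \<sigma> L \<in> mtopology frontier_of A \<and> x \<in> \<sigma> ` {0..L})"

definition stably_starlike_at :: "'a set \<Rightarrow> 'a \<Rightarrow> bool" where
  "stably_starlike_at A p \<longleftrightarrow> p \<in> mtopology interior_of A \<and>
     (\<exists>\<delta>>0. \<forall>x\<in>mball p \<delta>. starlike_wrt A x)"

end

end

theory Submission
  imports Defs
begin

text \<open>For a monotone continuous \<^term>\<open>\<phi>\<close> and a vector \<^term>\<open>u\<close>, the metric
  \<^term>\<open>dist x y + \<bar>\<phi> (x \<bullet> u) - \<phi> (y \<bullet> u)\<bar>\<close> is additive along Euclidean segments, and
  by strict convexity of the Euclidean norm only there; so its geodesics are the straight lines, and it
  is a straight G-space. If \<^term>\<open>\<phi>\<close> has infinite right derivative at \<^term>\<open>p \<bullet> u\<close>, the balls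
  around \<^term>\<open>p\<close> have outward cusps along the hyperplane through \<^term>\<open>p\<close> orthogonal to
  \<^term>\<open>u\<close>. A segment arriving at the tip of a cusp transversally to this hyperplane leaves the
  ball before reaching the tip, so the ball is not starlike with respect to any nearby point
  \<^term>\<open>p + \<eta> *\<^sub>R u\<close> with \<^term>\<open>\<eta> > (0::real)\<close>.
  A weighted sum of truncated cube roots centred at the rationals is steep at every rational, which
  gives a dense set of such \<^term>\<open>p\<close>.\<close>

section \<open>A monotone continuous function that is steep at every rational\<close>

lemma steep_monotone_function_exists:
  "\<exists>\<phi> :: real \<Rightarrow> real. mono \<phi> \<and> continuous_on UNIV \<phi> \<and>
    (\<forall>q\<in>\<rat>. \<forall>K. \<forall>\<^sub>F s in at_right 0. K * s < \<phi> (q + s) - \<phi> q)"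
proof -
  \<comment> \<open>Truncation bounds \<open>f k\<close> by \<open>(1/2)^k\<close>, so the series
    converges uniformly. Near 0 the function is still the cube root, with infinite slope at
    0.\<close>
  define g :: "real \<Rightarrow> real" where "g s = max (-1) (min 1 (root 3 s))" for s
  define r :: "nat \<Rightarrow> real" where "r = from_nat_into \<rat>"
  define f where "f k t = (1/2)^k * g (t - r k)" for k t
  define \<phi> where "\<phi> t = (\<Sum>k. f k t)" for t
  have f_le: "norm (f k t) \<le> (1/2)^k" for k t
    by (auto simp: f_def g_def abs_mult abs_le_iff)
  have geo: "summable (\<lambda>k. (1/2)^k :: real)"
    by (rule summable_geometric) simp
  have sm: "summable (\<lambda>k. f k t)" for t
    by (rule summable_comparison_test'[OF geo]) (rule f_le)
  have g_mono: "g s \<le> g t" if "s \<le> t" for s t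
    unfolding g_def using that by (intro max.mono min.mono) auto
  have f_mono: "f k s \<le> f k t" if "s \<le> t" for k s t
    using that by (auto simp: f_def intro: mult_left_mono g_mono)
  have "mono \<phi>"
    unfolding \<phi>_def by (intro monoI suminf_le sm f_mono)
  moreover have "continuous_on UNIV \<phi>"
  proof -
    have "uniform_limit UNIV (\<lambda>n t. \<Sum>k<n. f k t) \<phi> sequentially"
      unfolding \<phi>_def by (rule Weierstrass_m_test[OF _ geo]) (use f_le in auto)
    moreover have "continuous_on UNIV (\<lambda>t. \<Sum>k<n. f k t)" for n
      unfolding f_def g_def by (intro continuous_intros)
    ultimately show ?thesis
      by (intro uniform_limit_theorem[where F = sequentially]) auto
  qed
  moreover have "\<forall>\<^sub>F s in at_right 0. K * s < \<phi> (q + s) - \<phi> q" if "q \<in> \<rat>" for q K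
  proof -
    obtain k where k: "q = r k"
      using from_nat_into_surj[OF countable_rat \<open>q \<in> \<rat>\<close>] unfolding r_def by blast
    \<comment> \<open>All terms are monotone, so the increment of \<open>\<phi>\<close> dominates
      that of the single term centred at \<open>q\<close>.\<close>
    have le: "f k (q + s) - f k q \<le> \<phi> (q + s) - \<phi> q" if "0 \<le> s" for s
    proof -
      have "(\<Sum>i\<in>{k}. f i (q + s) - f i q) \<le> (\<Sum>i. f i (q + s) - f i q)"
      proof (rule sum_le_suminf)
        show "summable (\<lambda>i. f i (q + s) - f i q)"
          by (intro summable_diff sm)
        show "0 \<le> f i (q + s) - f i q" for i
          using f_mono[of q "q + s" i] that by linarith
      qed simp
      also have "\<dots> = \<phi> (q + s) - \<phi> q"
        unfolding \<phi>_def by (rule suminf_diff[OF sm sm, symmetric])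
      finally show ?thesis by simp
    qed
    \<comment> \<open>With \<open>c = root 3 s\<close>, the goal reduces to
      \<open>2^k * K * c^2 < 1\<close>. The bound \<open>s < 1 / L^3\<close> means
      \<open>c < 1 / L\<close>, and then \<open>L > 2^k * K\<close> and \<open>L \<ge> 1\<close>
      give \<open>2^k * K * c^2 \<le> L * c^2 < c < 1\<close>.\<close>
    define L where "L = max 1 (2^k * K + 1)"
    have L: "L \<ge> 1" "2^k * K < L" by (auto simp: L_def)
    have "K * s < \<phi> (q + s) - \<phi> q" if s: "0 < s" "s < 1 / L^3" for s
    proof -
      define c where "c = root 3 s"
      have c: "c > 0" "c^3 = s" using s by (auto simp: c_def)
      have "1 / L^3 \<le> 1" using L by simp
      then have "s < 1" using s by linarith
      then have c1: "c < 1" by (simp add: c_def)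
      have "0 < L^3" using L(1) by simp
      then have "s * L^3 < 1"
        using s(2) by (simp only: pos_less_divide_eq)
      then have "(c * L)^3 < 1^3"
        by (simp only: power_mult_distrib c(2) power_one)
      then have cL: "c * L < 1"
        by (rule power_less_imp_less_base) simp
      have "c * c * (2^k * K) \<le> c * c * L"
        using c L by (intro mult_left_mono) auto
      also have "\<dots> = c * (c * L)"
        by (rule mult.assoc)
      also have "\<dots> < c * 1"
        using cL c by (intro mult_strict_left_mono) auto
      finally have *: "c * c * (2^k * K) < 1"
        using c1 by linarith
      have "2^k * K * s = c * (c * c * (2^k * K))"
        unfolding c(2)[symmetric] by (simp add: power3_eq_cube mult_ac)
      also have "\<dots> < c * 1"
        using * c by (intro mult_strict_left_mono) auto
      finally have "K * s < (1/2)^k * c"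
        by (simp add: power_one_over pos_less_divide_eq mult_ac)
      also have "\<dots> = f k (q + s) - f k q"
        using c c1 by (simp add: f_def k g_def flip: c_def)
      also have "\<dots> \<le> \<phi> (q + s) - \<phi> q"
        using le s by simp
      finally show ?thesis .
    qed
    moreover have "0 < 1 / L^3" using L by simp
    ultimately show ?thesis
      unfolding eventually_at_right_field by blast
  qed
  ultimately show ?thesis by blast
qed

section \<open>The metric, its topology and completeness\<close>

locale projective_metric =
  fixes u :: "'a::euclidean_space" and \<phi> :: "real \<Rightarrow> real"
  assumes mono: "mono \<phi>" and cont: "continuous_on UNIV \<phi>"
begin

definition pd :: "'a \<Rightarrow> 'a \<Rightarrow> real" where
  "pd x y = dist x y + \<bar>\<phi> (x \<bullet> u) - \<phi> (y \<bullet> u)\<bar>"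

lemma dist_le_pd: "dist x y \<le> pd x y"
  by (simp add: pd_def)

sublocale Metric_space UNIV pd
proof
  show "pd x z \<le> pd x y + pd y z" for x y z
    using dist_triangle[of x z y] unfolding pd_def by linarith
  show "pd x y = 0 \<longleftrightarrow> x = y" for x y
    using dist_le_pd[of x y] zero_le_dist[of x y] by (metis antisym add_0 abs_zero diff_self dist_eq_0_iff pd_def)
qed (auto simp: pd_def dist_commute)

lemma continuous_on_pd: "continuous_on S (pd x)"
  unfolding pd_def
  by (intro continuous_intros continuous_on_compose2[OF cont]) auto

text \<open>Balls of \<open>pd\<close> lie in Euclidean balls because \<open>pd\<close> dominates
  \<open>dist\<close>; conversely they are Euclidean open because \<open>pd x\<close> is
  continuous.\<close>

lemma mtopology_eq: "mtopology = euclidean"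
proof (rule topology_eq[THEN iffD2], intro allI iffI)
  fix U :: "'a set"
  assume U: "openin mtopology U"
  show "openin euclidean U"
    unfolding open_openin[symmetric] open_contains_ball
  proof
    fix x assume "x \<in> U"
    then obtain r where r: "r > 0" "mball x r \<subseteq> U"
      using U by (auto simp: openin_mtopology)
    have "open (pd x -` {..<r})"
      by (intro open_vimage continuous_on_pd) auto
    moreover have "x \<in> pd x -` {..<r}"
      using r by simp
    ultimately obtain e where "e > 0" "ball x e \<subseteq> pd x -` {..<r}"
      by (metis open_contains_ball)
    then show "\<exists>e>0. ball x e \<subseteq> U"
      using r by (auto simp: subset_iff)
  qed
next
  fix U :: "'a set"
  assume "openin euclidean U"
  then have "open U" by simp
  moreover have "mball x r \<subseteq> ball x r" for x r
    using order.strict_trans1[OF dist_le_pd[of x]] by auto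
  ultimately show "openin mtopology U"
    unfolding openin_mtopology open_contains_ball by (meson order_trans subset_UNIV)
qed

lemma mcomplete: mcomplete
  unfolding mcomplete_def
proof (intro allI impI)
  fix \<sigma> :: "nat \<Rightarrow> 'a"
  assume "MCauchy \<sigma>"
  then have "Cauchy \<sigma>"
    unfolding MCauchy_def Cauchy_def by (meson dist_le_pd order.strict_trans1)
  then show "\<exists>x. limitin mtopology \<sigma> x sequentially"
    by (auto simp: mtopology_eq dest: Cauchy_convergent simp: convergent_def)
qed

section \<open>Metric betweenness is Euclidean betweenness\<close>

text \<open>The linear functional given by \<open>u\<close> keeps the order of points along a
  segment and the monotone \<open>\<phi>\<close> respects it, so both summands of \<open>pd\<close>
  are additive.\<close>

lemma pd_segment:
  assumes "w \<in> closed_segment x y"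
  shows "pd x w + pd w y = pd x y"
proof -
  have "dist x y = dist x w + dist w y"
    using assms by (simp flip: between between_mem_segment)
  moreover obtain t where t: "0 \<le> t" "t \<le> 1" "w = x + t *\<^sub>R (y - x)"
    using assms by (auto simp: closed_segment_def algebra_simps)
  have w: "w \<bullet> u = x \<bullet> u + t * (y \<bullet> u - x \<bullet> u)"
    by (simp add: t inner_simps)
  have "w \<bullet> u \<in> closed_segment (x \<bullet> u) (y \<bullet> u)"
    unfolding closed_segment_def using t(1,2) by (auto simp: w algebra_simps intro!: exI[of _ t])
  then have "x \<bullet> u \<le> w \<bullet> u \<and> w \<bullet> u \<le> y \<bullet> u \<or> y \<bullet> u \<le> w \<bullet> u \<and> w \<bullet> u \<le> x \<bullet> u"
    by (auto simp: closed_segment_eq_real_ivl split: if_splits)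
  then have "\<phi> (x \<bullet> u) \<le> \<phi> (w \<bullet> u) \<and> \<phi> (w \<bullet> u) \<le> \<phi> (y \<bullet> u) \<or>
      \<phi> (y \<bullet> u) \<le> \<phi> (w \<bullet> u) \<and> \<phi> (w \<bullet> u) \<le> \<phi> (x \<bullet> u)"
    using mono by (auto dest: monoD)
  ultimately show ?thesis
    unfolding pd_def by linarith
qed

text \<open>Each summand of \<open>pd\<close> obeys the triangle inequality, so equality for the sum
  forces equality for the Euclidean summand.\<close>

lemma segment_if_pd:
  assumes "pd x w + pd w y = pd x y"
  shows "w \<in> closed_segment x y"
proof -
  have "dist x y = dist x w + dist w y"
    using assms dist_triangle[of x y w] unfolding pd_def by linarith
  then show ?thesis
    by (simp flip: between between_mem_segment)
qed

text \<open>This is Busemann's uniqueness of prolongation. Both \<open>w\<close> and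
  \<open>z\<close> lie on the ray from \<open>x\<close> through \<open>y\<close>, so one of them
  lies between \<open>x\<close> and the other, and equal distances from \<open>x\<close> leave no
  gap between them.\<close>

lemma ray_unique:
  assumes "y \<noteq> x" "y \<in> closed_segment x w" "y \<in> closed_segment x z" "pd x w = pd x z"
  shows "w = z"
proof -
  \<comment> \<open>This treats the case where \<open>w\<close> is the point nearer to
    \<open>x\<close>; the other case follows by exchanging \<open>w\<close> and
    \<open>z\<close>.\<close>
  have *: "w = z"
    if "pd x w = pd x z" "a *\<^sub>R (w - x) = b *\<^sub>R (z - x)" "0 < a" "0 \<le> b" "b \<le> a" for a b w z
  proof -
    have "w - x = (1 / a) *\<^sub>R (a *\<^sub>R (w - x))"
      using that(3) by simp
    then have "w - x = (b / a) *\<^sub>R (z - x)"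
      unfolding that(2) by simp
    then have "w = (1 - b / a) *\<^sub>R x + (b / a) *\<^sub>R z"
      by (simp add: algebra_simps)
    moreover have "0 \<le> b / a" "b / a \<le> 1"
      using that by auto
    ultimately have "w \<in> closed_segment x z"
      unfolding closed_segment_def by blast
    then have "pd w z = 0"
      using pd_segment that(1) by fastforce
    then show ?thesis by simp
  qed
  obtain a where a: "0 \<le> a" "y - x = a *\<^sub>R (w - x)"
    using assms(2) by (auto simp: closed_segment_def algebra_simps)
  obtain b where b: "0 \<le> b" "y - x = b *\<^sub>R (z - x)"
    using assms(3) by (auto simp: closed_segment_def algebra_simps)
  have "a > 0" "b > 0"
    using a b assms(1) by (cases "a = 0"; cases "b = 0"; auto)+
  then show ?thesis
    using *[of w z a b] *[of z w b a] a b assms(4) by (metis linear less_imp_le)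
qed

text \<open>The distance from an endpoint serves as an injective coordinate on a segment; this
  identifies geodesics pointwise later on.\<close>

lemma segment_unique:
  assumes "w \<in> closed_segment x y" "z \<in> closed_segment x y" "pd x w = pd x z"
  shows "w = z"
proof (cases "x = y")
  case False
  have "pd y w = pd y z"
    using assms pd_segment by (metis add_left_cancel commute)
  have "w \<in> closed_segment x z \<or> z \<in> closed_segment x w"
  proof -
    obtain s where s: "0 \<le> s" "s \<le> 1" "w = x + s *\<^sub>R (y - x)"
      using assms by (auto simp: closed_segment_def algebra_simps)
    obtain t where t: "0 \<le> t" "t \<le> 1" "z = x + t *\<^sub>R (y - x)"
      using assms by (auto simp: closed_segment_def algebra_simps)
    have aux: "x + s *\<^sub>R v \<in> closed_segment x (x + t *\<^sub>R v)" if "0 \<le> s" "s \<le> t" for s t v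
    proof (cases "t = 0")
      case False
      then have "x + s *\<^sub>R v = (1 - s / t) *\<^sub>R x + (s / t) *\<^sub>R (x + t *\<^sub>R v)"
        by (simp add: algebra_simps)
      moreover have "0 \<le> s / t" "s / t \<le> 1"
        using that by (auto simp: divide_le_eq_1)
      ultimately show ?thesis
        unfolding closed_segment_def by blast
    qed (use that in auto)
    show ?thesis
      using aux[of s t] aux[of t s] s t by (metis linear)
  qed
  then have "pd w z = 0"
    using pd_segment assms(3) by (metis add_cancel_right_right commute)
  then show ?thesis by simp
qed (use assms in auto)

section \<open>Lines and shortest paths\<close>

text \<open>The Euclidean line through the two points is reparametrised by signed
  \<open>pd\<close>-arc length: \<open>\<tau>\<close> is the signed distance from \<open>x\<close>,
  and the metric line uses its inverse \<open>\<theta>\<close>.\<close>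

lemma line_through:
  assumes "x \<noteq> y"
  obtains g where "metric_line g" "g 0 = x" "g (pd x y) = y"
proof -
  define v where "v = y - x"
  \<comment> \<open>The sign makes \<open>e * \<phi>\<close> nondecreasing along the line, so the
    absolute value in \<open>pd\<close> opens the same way everywhere.\<close>
  define e :: real where "e = (if v \<bullet> u \<ge> 0 then 1 else -1)"
  define \<tau> where "\<tau> t = t * norm v + e * (\<phi> ((x + t *\<^sub>R v) \<bullet> u) - \<phi> (x \<bullet> u))" for t
  have v: "norm v > 0" using assms by (simp add: v_def)
  have "\<phi> ((x + s *\<^sub>R v) \<bullet> u) \<le> \<phi> ((x + t *\<^sub>R v) \<bullet> u)" if "s \<le> t" "v \<bullet> u \<ge> 0" for s t
    by (rule monoD[OF mono]) (use that in \<open>simp add: inner_simps mult_right_mono\<close>)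
  moreover have "\<phi> ((x + t *\<^sub>R v) \<bullet> u) \<le> \<phi> ((x + s *\<^sub>R v) \<bullet> u)" if "s \<le> t" "v \<bullet> u < 0" for s t
    by (rule monoD[OF mono]) (use that in \<open>simp add: inner_simps mult_right_mono_neg\<close>)
  ultimately have e_mono: "e * \<phi> ((x + s *\<^sub>R v) \<bullet> u) \<le> e * \<phi> ((x + t *\<^sub>R v) \<bullet> u)" if "s \<le> t" for s t
    using that by (auto simp: e_def)
  have pd_\<tau>: "pd (x + s *\<^sub>R v) (x + t *\<^sub>R v) = \<tau> t - \<tau> s" if "s \<le> t" for s t
  proof -
    have "dist (x + s *\<^sub>R v) (x + t *\<^sub>R v) = norm ((t - s) *\<^sub>R v)"
      by (simp add: dist_norm norm_minus_commute algebra_simps)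
    also have "\<dots> = (t - s) * norm v"
      using that by simp
    finally show ?thesis
      using e_mono[OF that] unfolding pd_def \<tau>_def by (auto simp: e_def algebra_simps split: if_splits)
  qed
  have pd_\<tau>': "pd (x + s *\<^sub>R v) (x + t *\<^sub>R v) = \<bar>\<tau> t - \<tau> s\<bar>" for s t
    using pd_\<tau>[of s t] pd_\<tau>[of t s] commute[of "x + s *\<^sub>R v" "x + t *\<^sub>R v"]
      nonneg[of "x + s *\<^sub>R v" "x + t *\<^sub>R v"]
    by (cases "s \<le> t") auto
  have \<tau>0: "\<tau> 0 = 0" by (simp add: \<tau>_def)
  have \<tau>_cont: "continuous_on S \<tau>" for S
    unfolding \<tau>_def by (intro continuous_intros continuous_on_compose2[OF cont]) auto
  \<comment> \<open>The Euclidean summand alone makes \<open>\<tau>\<close> unbounded in both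
    directions, which gives surjectivity by the intermediate value theorem.\<close>
  have ge: "\<tau> t \<ge> t * norm v" if "t \<ge> 0" for t
    using e_mono[OF that] by (simp add: \<tau>_def algebra_simps)
  have le: "\<tau> t \<le> t * norm v" if "t \<le> 0" for t
    using e_mono[OF that] by (simp add: \<tau>_def algebra_simps)
  have surj: "\<exists>t. \<tau> t = s" for s
  proof -
    define r where "r = \<bar>s\<bar> / norm v"
    have r: "r \<ge> 0" "r * norm v = \<bar>s\<bar>" using v by (auto simp: r_def)
    have "\<tau> (-r) \<le> s" "s \<le> \<tau> r"
      using ge[of r] le[of "-r"] r by auto
    then show ?thesis
      using IVT'[of \<tau> "-r" s r] r \<tau>_cont by auto
  qed
  then obtain \<theta> where \<theta>: "\<tau> (\<theta> s) = s" for s by metis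
  have \<theta>\<tau>: "\<theta> (\<tau> t) = t" for t
  proof -
    have "pd (x + \<theta> (\<tau> t) *\<^sub>R v) (x + t *\<^sub>R v) = 0"
      by (simp add: pd_\<tau>' \<theta> del: mdist_zero zero)
    then show ?thesis
      using v by auto
  qed
  show ?thesis
  proof
    show "metric_line (\<lambda>s. x + \<theta> s *\<^sub>R v)"
      unfolding metric_line_def pd_\<tau>' \<theta> by (auto simp: abs_minus_commute)
    show "x + \<theta> 0 *\<^sub>R v = x"
      using \<theta>\<tau>[of 0] by (simp add: \<tau>0)
    have "\<tau> 1 = pd x y"
      using pd_\<tau>[of 0 1] by (simp add: \<tau>0 v_def)
    then show "x + \<theta> (pd x y) *\<^sub>R v = y"
      using \<theta>\<tau>[of 1] by (simp add: v_def)
  qed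
qed

lemma shortest_path_mem_segment:
  assumes "shortest_path a b \<gamma>" "a \<le> s" "s \<le> t" "t \<le> r" "r \<le> b"
  shows "\<gamma> t \<in> closed_segment (\<gamma> s) (\<gamma> r)"
  using assms by (intro segment_if_pd) (auto simp: shortest_path_def)

lemma metric_line_mem_segment:
  assumes "metric_line g" "s \<le> t" "t \<le> r"
  shows "g t \<in> closed_segment (g s) (g r)"
  using assms by (intro segment_if_pd) (auto simp: metric_line_def)

lemma metric_line_shortest_path:
  assumes "metric_line g" "a < b"
  shows "shortest_path a b (restrict g {a..b})"
  using assms by (auto simp: metric_line_def shortest_path_def)

text \<open>Between the two common points the lines agree by \<open>segment_unique\<close>, beyond
  them by \<open>ray_unique\<close>.\<close>

lemma metric_line_eqI:
  assumes g: "metric_line g" and h: "metric_line h"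
    and ab: "a < b" "g a = h a" "g b = h b"
  shows "g = h"
proof
  fix s
  have dg: "pd (g s) (g t) = \<bar>s - t\<bar>" and dh: "pd (h s) (h t) = \<bar>s - t\<bar>" for s t
    using g h by (auto simp: metric_line_def)
  have ne: "g a \<noteq> g b"
    using dg[of a b] ab by auto
  have sym: "closed_segment x y = closed_segment y x" for x y :: 'a
    by (rule closed_segment_commute)
  consider "s < a" | "a \<le> s" "s \<le> b" | "b < s" by linarith
  then show "g s = h s"
  proof cases
    case 1
    then show ?thesis
      using metric_line_mem_segment[OF g, of s a b] metric_line_mem_segment[OF h, of s a b]
        dg[of b s] dh[of b s] ab ne
      by (intro ray_unique[of "g a" "g b"]) (auto simp: sym)
  next
    case 2
    then show ?thesis
      using metric_line_mem_segment[OF g, of a s b] metric_line_mem_segment[OF h, of a s b]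
        dg[of a s] dh[of a s] ab
      by (intro segment_unique[of _ "g a" "g b"]) auto
  next
    case 3
    then show ?thesis
      using metric_line_mem_segment[OF g, of a b s] metric_line_mem_segment[OF h, of a b s]
        dg[of a s] dh[of a s] ab ne
      by (intro ray_unique[of "g b" "g a"]) auto
  qed
qed

text \<open>The line through the two endpoints, shifted to start at parameter \<open>a\<close>,
  meets each \<open>\<gamma> s\<close> at the same distance from \<open>\<gamma> a\<close> on the
  same segment. Extensionality settles the values outside \<open>{a..b}\<close>.\<close>

lemma shortest_path_extends:
  assumes \<gamma>: "shortest_path a b \<gamma>"
  obtains g where "metric_line g" "restrict g {a..b} = \<gamma>"
proof -
  have d\<gamma>: "pd (\<gamma> s) (\<gamma> t) = \<bar>s - t\<bar>" if "s \<in> {a..b}" "t \<in> {a..b}" for s t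
    using \<gamma> that by (auto simp: shortest_path_def)
  have "a < b" using \<gamma> by (simp add: shortest_path_def)
  then have pab: "pd (\<gamma> a) (\<gamma> b) = b - a"
    using d\<gamma>[of a b] by simp
  then have "\<gamma> a \<noteq> \<gamma> b" using \<open>a < b\<close> by auto
  then obtain h where h: "metric_line h" "h 0 = \<gamma> a" "h (b - a) = \<gamma> b"
    using line_through pab by metis
  define g where "g s = h (s - a)" for s
  have g: "metric_line g" "g a = \<gamma> a" "g b = \<gamma> b"
    using h by (auto simp: g_def metric_line_def)
  have "g s = \<gamma> s" if "s \<in> {a..b}" for s
  proof (rule segment_unique)
    show "g s \<in> closed_segment (\<gamma> a) (\<gamma> b)"
      using metric_line_mem_segment[OF g(1), of a s b] that g by simp
    show "\<gamma> s \<in> closed_segment (\<gamma> a) (\<gamma> b)"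
      using shortest_path_mem_segment[OF \<gamma>, of a s b] that by simp
    show "pd (\<gamma> a) (g s) = pd (\<gamma> a) (\<gamma> s)"
      using g d\<gamma>[of a s] that by (auto simp: metric_line_def simp flip: g(2))
  qed
  moreover have "\<gamma> \<in> extensional {a..b}"
    using \<gamma> by (auto simp: shortest_path_def PiE_def)
  ultimately have "restrict g {a..b} = \<gamma>"
    by (auto simp: extensional_def restrict_def fun_eq_iff)
  with g(1) show ?thesis by (rule that)
qed

lemma continuous_on_metric_line:
  assumes "metric_line g"
  shows "continuous_on S g"
proof (rule continuous_on_subset)
  show "continuous_on UNIV g"
    unfolding continuous_on_iff
  proof (intro ballI allI impI)
    fix s e :: real assume "e > 0"
    moreover have "dist (g t) (g s) \<le> dist t s" for t
      using dist_le_pd[of "g t" "g s"] assms by (simp add: metric_line_def dist_real_def)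
    ultimately show "\<exists>d>0. \<forall>t\<in>UNIV. dist t s < d \<longrightarrow> dist (g t) (g s) < e"
      by (metis order.strict_trans1)
  qed
qed simp

section \<open>Unique maximal extensions inside Euclidean balls\<close>

text \<open>Convexity of the Euclidean ball makes the preimage an interval, and compactness of the
  ball bounds \<open>pd (g 0) (g s) = \<bar>s\<bar>\<close> on it. The preimage may be empty, with
  \<open>b < a\<close>.\<close>

lemma metric_line_vimage_cball:
  assumes g: "metric_line g"
  obtains a b where "g -` cball p r = {a..b}"
proof -
  let ?T = "g -` cball p r"
  have "closed ?T"
    by (intro closed_vimage continuous_on_metric_line g) auto
  moreover have "bounded ?T"
  proof -
    have "bounded (pd (g 0) ` cball p r)"
      by (intro compact_imp_bounded compact_continuous_image continuous_on_pd compact_cball)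
    then obtain B where B: "\<And>x. x \<in> cball p r \<Longrightarrow> \<bar>pd (g 0) x\<bar> \<le> B"
      unfolding bounded_iff by (auto simp del: mem_cball)
    have "norm s \<le> B" if "s \<in> ?T" for s
      using B[of "g s"] that g by (simp add: metric_line_def)
    then show ?thesis unfolding bounded_iff by blast
  qed
  moreover have "is_interval ?T"
    unfolding is_interval_1
  proof (intro ballI allI impI)
    fix s r' t assume *: "s \<in> ?T" "r' \<in> ?T" "s \<le> t \<and> t \<le> r'"
    then have "closed_segment (g s) (g r') \<subseteq> cball p r"
      by (intro closed_segment_subset) auto
    then show "t \<in> ?T"
      using metric_line_mem_segment[OF g, of s t r'] * by auto
  qed
  ultimately show ?thesis
    using that by (metis compact_eq_bounded_closed connected_compact_interval_1 is_interval_connected_1)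
qed

text \<open>Every extension of \<open>\<gamma>\<close> is a restriction of one line
  \<open>g\<close>, so extensions within the ball correspond to the intervals between
  \<open>{a..b}\<close> and the full preimage \<open>{a'..b'}\<close>, which is the largest.\<close>

lemma maximal_extension_in_cball:
  assumes \<gamma>: "shortest_path a b \<gamma>" "\<gamma> ` {a..b} \<subseteq> cball p r"
  shows "\<exists>a' b' \<sigma>. \<sigma> a' \<in> sphere p r \<and> \<sigma> b' \<in> sphere p r \<and>
    (\<forall>e. maximal_extension_in (cball p r) (a, b, \<gamma>) e \<longleftrightarrow> e = (a', b', \<sigma>))"
proof -
  let ?C = "cball p r"
  obtain g where g: "metric_line g" "restrict g {a..b} = \<gamma>"
    using shortest_path_extends[OF \<gamma>(1)] by metis
  obtain a' b' where V: "g -` ?C = {a'..b'}"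
    using metric_line_vimage_cball[OF g(1)] by metis
  have "a < b" using \<gamma> by (simp add: shortest_path_def)
  have "{a..b} \<subseteq> {a'..b'}"
    using \<gamma>(2) unfolding V[symmetric] g(2)[symmetric] by (auto simp del: mem_cball)
  then have ab': "a' \<le> a" "b \<le> b'" "a' < b'"
    using \<open>a < b\<close> by auto
  let ?\<sigma> = "restrict g {a'..b'}"
  \<comment> \<open>The initial path is left general because maximality also concerns extensions of
    the candidate itself, not only of \<open>\<gamma>\<close>.\<close>
  have ext: "extension_in ?C (s, t, \<tau>) (s', t', \<rho>) \<longleftrightarrow>
      a' \<le> s' \<and> s' \<le> s \<and> t \<le> t' \<and> t' \<le> b' \<and> \<rho> = restrict g {s'..t'}"
    if st: "s < t" "\<tau> = restrict g {s..t}" for s t s' t' \<tau> \<rho>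
  proof
    assume *: "extension_in ?C (s, t, \<tau>) (s', t', \<rho>)"
    then have \<rho>: "shortest_path s' t' \<rho>" "\<rho> ` {s'..t'} \<subseteq> ?C" "s' \<le> s" "t \<le> t'" "restrict \<rho> {s..t} = \<tau>"
      by (auto simp: extension_in_def)
    obtain h where h: "metric_line h" "restrict h {s'..t'} = \<rho>"
      using shortest_path_extends[OF \<rho>(1)] by metis
    have eq: "h x = g x" if "x \<in> {s..t}" for x
      using \<rho>(3,4) fun_cong[OF \<rho>(5), of x] that unfolding st h(2)[symmetric] by auto
    have "h = g"
      using eq[of s] eq[of t] st by (intro metric_line_eqI[OF h(1) g(1), of s t]) auto
    moreover have "{s'..t'} \<subseteq> {a'..b'}"
      using \<rho>(2) unfolding V[symmetric] h(2)[symmetric] \<open>h = g\<close> by (auto simp del: mem_cball)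
    ultimately show "a' \<le> s' \<and> s' \<le> s \<and> t \<le> t' \<and> t' \<le> b' \<and> \<rho> = restrict g {s'..t'}"
      using \<rho> h st by auto
  next
    assume *: "a' \<le> s' \<and> s' \<le> s \<and> t \<le> t' \<and> t' \<le> b' \<and> \<rho> = restrict g {s'..t'}"
    then have "g ` {s'..t'} \<subseteq> ?C"
      using V by (auto simp del: mem_cball)
    moreover have "shortest_path s' t' (restrict g {s'..t'})"
      using * st by (intro metric_line_shortest_path g) auto
    ultimately show "extension_in ?C (s, t, \<tau>) (s', t', \<rho>)"
      using * st by (force simp: extension_in_def simp del: mem_cball)
  qed
  have "maximal_extension_in ?C (a, b, \<gamma>) (s, t, \<tau>) \<longleftrightarrow> (s, t, \<tau>) = (a', b', ?\<sigma>)" for s t \<tau>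
  proof
    assume *: "maximal_extension_in ?C (a, b, \<gamma>) (s, t, \<tau>)"
    then have st: "a' \<le> s" "s \<le> a" "b \<le> t" "t \<le> b'" "\<tau> = restrict g {s..t}"
      using ext[of a b \<gamma> s t \<tau>] \<open>a < b\<close> g(2) by (auto simp: maximal_extension_in_def)
    then have "extension_in ?C (s, t, \<tau>) (a', b', ?\<sigma>)"
      using \<open>a < b\<close> by (subst ext) auto
    then show "(s, t, \<tau>) = (a', b', ?\<sigma>)"
      using * by (auto simp: maximal_extension_in_def)
  next
    assume *: "(s, t, \<tau>) = (a', b', ?\<sigma>)"
    show "maximal_extension_in ?C (a, b, \<gamma>) (s, t, \<tau>)"
      unfolding maximal_extension_in_def *
      using ext[of a b \<gamma> a' b' ?\<sigma>] ext[of a' b' ?\<sigma>] \<open>a < b\<close> ab' g(2) by auto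
  qed
  then have "maximal_extension_in ?C (a, b, \<gamma>) e \<longleftrightarrow> e = (a', b', ?\<sigma>)" for e
    by (cases e) auto
  \<comment> \<open>At an endpoint inside the open ball, the line would stay in the ball on both
    sides, against \<open>{a'..b'}\<close> being the whole preimage.\<close>
  moreover have "g s \<in> sphere p r" if "s = a' \<or> s = b'" for s
  proof (rule ccontr)
    assume "g s \<notin> sphere p r"
    moreover have "g s \<in> ?C"
      using that ab' V by (metis atLeastAtMost_iff less_imp_le order_refl vimageE vimageI2 vimage_eq)
    ultimately have "s \<in> g -` ball p r"
      by auto
    moreover have "open (g -` ball p r)"
      by (intro open_vimage continuous_on_metric_line g) auto
    ultimately obtain e where e: "e > 0" "ball s e \<subseteq> g -` ball p r"
      by (metis open_contains_ball)
    moreover have "ball p r \<subseteq> ?C" by auto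
    ultimately have "ball s e \<subseteq> {a'..b'}"
      using V by blast
    moreover have "s - e/2 \<in> ball s e" "s + e/2 \<in> ball s e"
      using e by (auto simp: dist_real_def)
    ultimately have "s - e/2 \<in> {a'..b'}" "s + e/2 \<in> {a'..b'}"
      by blast+
    then show False
      using that e by auto
  qed
  ultimately show ?thesis
    using ab' by (intro exI[of _ a'] exI[of _ b'] exI[of _ ?\<sigma>]) simp
qed

text \<open>The neighbourhood is a closed Euclidean ball rather than a \<open>pd\<close>-ball,
  because its convexity is immediate; any positive radius would serve.\<close>

lemma local_unique_extension: local_unique_extension
  unfolding local_unique_extension_def
proof
  fix p :: 'a
  have cl: "mtopology closure_of cball p 1 = cball p 1"
    by (simp add: mtopology_eq)
  have fr: "mtopology frontier_of cball p 1 = sphere p 1"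
    by (simp add: mtopology_eq frontier_of_def cball_diff_eq_sphere)
  have *: "(\<exists>!e. maximal_extension_in (cball p 1) (a, b, \<gamma>) e) \<and>
      (\<forall>a' b' \<sigma>. maximal_extension_in (cball p 1) (a, b, \<gamma>) (a', b', \<sigma>) \<longrightarrow>
        \<sigma> a' \<in> sphere p 1 \<and> \<sigma> b' \<in> sphere p 1)"
    if \<gamma>: "shortest_path a b \<gamma> \<and> \<gamma> ` {a..b} \<subseteq> cball p 1" for a b \<gamma>
  proof -
    obtain a' b' \<sigma> where "\<sigma> a' \<in> sphere p 1" "\<sigma> b' \<in> sphere p 1"
      "\<forall>e. maximal_extension_in (cball p 1) (a, b, \<gamma>) e \<longleftrightarrow> e = (a', b', \<sigma>)"
      using maximal_extension_in_cball[OF \<gamma>[THEN conjunct1] \<gamma>[THEN conjunct2]] by blast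
    then show ?thesis
      by (intro conjI ex1I[of _ "(a', b', \<sigma>)"] allI impI) (simp_all del: split_paired_All)
  qed
  have "p \<in> mtopology interior_of cball p 1"
    by (simp add: mtopology_eq)
  with * show "\<exists>U\<subseteq>UNIV. p \<in> mtopology interior_of U \<and>
      (\<forall>a b \<gamma>. shortest_path a b \<gamma> \<and> \<gamma> ` {a..b} \<subseteq> U \<longrightarrow>
        (\<exists>!e. maximal_extension_in (mtopology closure_of U) (a, b, \<gamma>) e) \<and>
        (\<forall>a' b' \<sigma>. maximal_extension_in (mtopology closure_of U) (a, b, \<gamma>) (a', b', \<sigma>) \<longrightarrow>
          \<sigma> a' \<in> mtopology frontier_of U \<and> \<sigma> b' \<in> mtopology frontier_of U))"
    by (intro exI[of _ "cball p 1"] conjI) (simp_all only: cl fr, simp_all)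
qed

lemma straight_G_space: straight_G_space
proof -
  have "geodesic_space"
    unfolding geodesic_space_def
  proof (intro ballI impI)
    fix x y :: 'a assume "x \<noteq> y"
    then obtain g where g: "metric_line g" "g 0 = x" "g (pd x y) = y"
      by (rule line_through)
    have "pd x y > 0" using \<open>x \<noteq> y\<close> by simp
    then have "shortest_path 0 (pd x y) (restrict g {0..pd x y})"
      by (rule metric_line_shortest_path[OF g(1)])
    moreover have "restrict g {0..pd x y} 0 = x" "restrict g {0..pd x y} (pd x y) = y"
      using g \<open>pd x y > 0\<close> by auto
    ultimately show "\<exists>a b \<gamma>. shortest_path a b \<gamma> \<and> \<gamma> a = x \<and> \<gamma> b = y"
      by blast
  qed
  moreover have "locally_compact_space mtopology"
    unfolding mtopology_eq by (simp add: locally_compact_space_euclidean)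
  ultimately show ?thesis
    unfolding straight_G_space_def G_space_def
    using mcomplete local_unique_extension shortest_path_extends by metis
qed

section \<open>Failure of stable starlikeness\<close>

text \<open>The path through \<open>y\<close> provided by starlikeness runs along the segment: by
  \<open>segment_unique\<close>, its point at parameter \<open>pd x w\<close> is \<open>w\<close>.
  Thus one segment leaving \<open>A\<close> refutes starlikeness.\<close>

lemma starlike_imp_segment_subset:
  assumes "starlike_wrt A x" "y \<in> A" "y \<noteq> x"
  shows "closed_segment x y \<subseteq> A"
proof
  fix w assume w: "w \<in> closed_segment x y"
  obtain L \<sigma> where \<sigma>: "shortest_path 0 L \<sigma>" "\<sigma> ` {0..L} \<subseteq> A" "\<sigma> 0 = x" "y \<in> \<sigma> ` {0..L}"
    using assms unfolding starlike_wrt_def by blast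
  then obtain t where t: "t \<in> {0..L}" "y = \<sigma> t" by blast
  have d: "pd x (\<sigma> s) = s" if "s \<in> {0..L}" for s
    using \<sigma> that by (auto simp: shortest_path_def simp flip: \<sigma>(3))
  have s: "pd x w \<in> {0..t}"
    using pd_segment[OF w] d[OF t(1), folded t(2)] nonneg[of w y] nonneg[of x w]
    unfolding atLeastAtMost_iff by linarith
  have "\<sigma> (pd x w) = w"
  proof (rule segment_unique[OF _ w])
    show "\<sigma> (pd x w) \<in> closed_segment x y"
      using shortest_path_mem_segment[OF \<sigma>(1), of 0 "pd x w" t] s t \<sigma>(3) by auto
    show "pd x (\<sigma> (pd x w)) = pd x w"
      using d s t by auto
  qed
  moreover have "\<sigma> (pd x w) \<in> A"
    using \<sigma>(2) s t by auto
  ultimately show "w \<in> A" by simp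
qed

text \<open>Moving a fraction \<open>t\<close> from the tip \<open>p + v'\<close> towards
  \<open>p + \<eta> *\<^sub>R u\<close> costs at most \<open>t * \<epsilon>\<close> of Euclidean
  distance from \<open>p\<close>, while steepness adds more than \<open>t * \<epsilon>\<close>
  through \<open>\<phi>\<close> for a suitably small \<open>t\<close>.\<close>

lemma not_stably_starlike_at:
  assumes u: "u \<noteq> 0" and v: "v \<bullet> u = 0" "v \<noteq> 0" and "\<epsilon> > 0"
    and steep: "\<And>K. \<forall>\<^sub>F s in at_right 0. K * s < \<phi> (p \<bullet> u + s) - \<phi> (p \<bullet> u)"
  shows "\<not> stably_starlike_at (mcball p \<epsilon>) p"
proof
  assume "stably_starlike_at (mcball p \<epsilon>) p"
  then obtain \<delta> where \<delta>: "\<delta> > 0" "\<And>x. x \<in> mball p \<delta> \<Longrightarrow> starlike_wrt (mcball p \<epsilon>) x"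
    by (auto simp: stably_starlike_at_def)
  \<comment> \<open>Since \<open>v'\<close> is orthogonal to \<open>u\<close>, the
    \<open>\<phi>\<close>-term vanishes and the tip \<open>p + v'\<close> has
    \<open>pd\<close>-distance exactly \<open>\<epsilon>\<close> from \<open>p\<close>.\<close>
  define v' where "v' = (\<epsilon> / norm v) *\<^sub>R v"
  have v': "v' \<bullet> u = 0" "norm v' = \<epsilon>"
    using v \<open>\<epsilon> > 0\<close> by (auto simp: v'_def)
  obtain \<eta> where \<eta>: "\<eta> > 0" "pd p (p + \<eta> *\<^sub>R u) < \<delta>"
  proof -
    have "continuous_on UNIV (\<lambda>\<eta>. pd p (p + \<eta> *\<^sub>R u))"
      by (intro continuous_on_compose2[OF continuous_on_pd] continuous_intros) auto
    then have "(\<lambda>\<eta>. pd p (p + \<eta> *\<^sub>R u)) \<midarrow>0\<rightarrow> pd p (p + 0 *\<^sub>R u)"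
      by (metis UNIV_I continuous_on_def)
    then have "((\<lambda>\<eta>. pd p (p + \<eta> *\<^sub>R u)) \<longlongrightarrow> 0) (at_right 0)"
      by (auto intro: filterlim_mono[OF _ order_refl at_le])
    then have "\<forall>\<^sub>F \<eta> in at_right 0. pd p (p + \<eta> *\<^sub>R u) < \<delta>"
      using \<delta>(1) by (rule order_tendstoD)
    then have "\<forall>\<^sub>F \<eta> in at_right 0. pd p (p + \<eta> *\<^sub>R u) < \<delta> \<and> \<eta> > 0"
      by (intro eventually_conj) (auto simp: eventually_at_right_less)
    then show ?thesis
      using that eventually_happens[of _ "at_right (0::real)"] by auto
  qed
  \<comment> \<open>This is the height of \<open>?x\<close> above \<open>p\<close> in the direction
    \<open>u\<close>, so the point at fraction \<open>t\<close> of the way from \<open>?y\<close> to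
    \<open>?x\<close> has height \<open>t * m\<close>.\<close>
  define m where "m = \<eta> * (u \<bullet> u)"
  have m: "m > 0" using \<eta> u by (simp add: m_def)
  let ?x = "p + \<eta> *\<^sub>R u" and ?y = "p + v'"
  have "?y \<in> mcball p \<epsilon>"
    using v' by (simp add: pd_def dist_norm inner_simps)
  moreover have "?y \<noteq> ?x"
    using v' m by (auto simp: m_def)
  moreover have "starlike_wrt (mcball p \<epsilon>) ?x"
    using \<delta> \<eta> by simp
  ultimately have seg: "closed_segment ?x ?y \<subseteq> mcball p \<epsilon>"
    by (intro starlike_imp_segment_subset)
  \<comment> \<open>The slope \<open>\<epsilon> / m\<close> is chosen so that at height
    \<open>s = t * m\<close> the increment of \<open>\<phi>\<close> exceeds
    \<open>t * \<epsilon>\<close>.\<close>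
  have "\<forall>\<^sub>F s in at_right 0. (\<epsilon> / m) * s < \<phi> (p \<bullet> u + s) - \<phi> (p \<bullet> u) \<and> s > 0 \<and> s < m"
    by (intro eventually_conj steep) (auto simp: eventually_at_right_less eventually_at_right_field m intro: exI[of _ m])
  then obtain s where s: "(\<epsilon> / m) * s < \<phi> (p \<bullet> u + s) - \<phi> (p \<bullet> u)" "0 < s" "s < m"
    using eventually_happens[of _ "at_right (0::real)"] by auto
  define t where "t = s / m"
  have t: "0 < t" "t < 1" "t * m = s"
    using s m by (auto simp: t_def)
  define w where "w = t *\<^sub>R ?x + (1 - t) *\<^sub>R ?y"
  have "w \<in> closed_segment ?y ?x"
    unfolding closed_segment_def w_def using t by (auto intro: exI[of _ t])
  then have "pd p w \<le> \<epsilon>"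
    using seg by (auto simp: closed_segment_commute)
  have w: "w - p = (t * \<eta>) *\<^sub>R u + (1 - t) *\<^sub>R v'"
    by (simp add: w_def algebra_simps)
  have "w \<bullet> u = p \<bullet> u + (w - p) \<bullet> u"
    by (simp add: inner_simps)
  also have "\<dots> = p \<bullet> u + s"
    unfolding w using v' t(3) by (simp add: inner_simps m_def mult.assoc)
  finally have wu: "w \<bullet> u = p \<bullet> u + s" .
  \<comment> \<open>By Pythagoras, the component along \<open>u\<close> can only increase the
    Euclidean distance from \<open>p\<close>.\<close>
  have "(norm ((1 - t) *\<^sub>R v'))\<^sup>2 \<le> (norm ((t * \<eta>) *\<^sub>R u))\<^sup>2 + (norm ((1 - t) *\<^sub>R v'))\<^sup>2"
    by simp
  also have "\<dots> = (norm (w - p))\<^sup>2"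
    unfolding w using v' by (intro norm_add_Pythagorean[symmetric]) (simp add: orthogonal_def inner_commute)
  finally have "norm ((1 - t) *\<^sub>R v') \<le> norm (w - p)"
    by (rule power2_le_imp_le) simp
  then have "(1 - t) * \<epsilon> \<le> dist p w"
    using t v' by (simp add: dist_norm norm_minus_commute)
  moreover have "t * \<epsilon> < \<bar>\<phi> (p \<bullet> u) - \<phi> (w \<bullet> u)\<bar>"
    using s(1) unfolding wu t_def by (simp add: mult.commute)
  ultimately have "\<epsilon> < pd p w"
    unfolding pd_def by (simp add: algebra_simps)
  with \<open>pd p w \<le> \<epsilon>\<close> show False by simp
qed

end

section \<open>Assembly in coordinates\<close>

theorem propositionA2:
  assumes "CARD('n::finite) \<ge> 2"
  shows "\<exists>(d :: real ^ 'n \<Rightarrow> real ^ 'n \<Rightarrow> real) (S :: (real ^ 'n) set).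
           Metric_space UNIV d \<and>
           Metric_space.mtopology UNIV d = euclidean \<and>
           Metric_space.straight_G_space UNIV d \<and>
           closure S = UNIV \<and>
           (\<forall>p\<in>S. \<forall>\<epsilon>>0.
              \<not> Metric_space.stably_starlike_at UNIV d (Metric_space.mcball UNIV d p \<epsilon>) p)"
proof -
  obtain i j :: 'n where ij: "i \<noteq> j"
    using assms by (metis UNIV_I card_2_iff' card_le_Suc0_iff_eq finite not_less_eq_eq numeral_2_eq_2)
  obtain \<phi> :: "real \<Rightarrow> real" where \<phi>: "mono \<phi>" "continuous_on UNIV \<phi>"
    "\<forall>q\<in>\<rat>. \<forall>K. \<forall>\<^sub>F s in at_right 0. K * s < \<phi> (q + s) - \<phi> q"
    using steep_monotone_function_exists by blast
  \<comment> \<open>Dimension at least 2 provides \<open>?v\<close> orthogonal to the steep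
    direction \<open>?u\<close>, as the tip of the cusp requires.\<close>
  let ?u = "axis i 1 :: real ^ 'n" and ?v = "axis j 1 :: real ^ 'n"
  interpret projective_metric ?u \<phi>
    using \<phi> by unfold_locales
  \<comment> \<open>A union of hyperplanes at rational height: \<open>\<phi>\<close> is steep at
    \<open>p \<bullet> ?u\<close> for each \<open>p\<close> in it, and a small move along
    \<open>?u\<close> reaches it from any point.\<close>
  define S where "S = {p :: real ^ 'n. p \<bullet> ?u \<in> \<rat>}"
  have "x \<in> closure S" for x
    unfolding closure_approachable
  proof (intro allI impI)
    fix e :: real assume "e > 0"
    then obtain q where q: "q \<in> \<rat>" "x \<bullet> ?u < q" "q < x \<bullet> ?u + e"
      using Rats_dense_in_real[of "x \<bullet> ?u" "x \<bullet> ?u + e"] by auto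
    have "?u \<bullet> ?u = 1"
      by (simp add: inner_axis_axis)
    then have "x + (q - x \<bullet> ?u) *\<^sub>R ?u \<in> S"
      using q(1) unfolding S_def by (simp only: mem_Collect_eq inner_add_left inner_scaleR_left) simp
    moreover have "dist (x + (q - x \<bullet> ?u) *\<^sub>R ?u) x < e"
      using q by (simp add: dist_norm)
    ultimately show "\<exists>y\<in>S. dist y x < e" by blast
  qed
  then have "closure S = UNIV" by auto
  moreover have "\<not> stably_starlike_at (mcball p \<epsilon>) p" if "p \<in> S" "\<epsilon> > 0" for p \<epsilon>
    using that ij \<phi>(3)
    by (intro not_stably_starlike_at[of ?v]) (simp_all add: S_def inner_axis_axis axis_eq_0_iff)
  ultimately show ?thesis
    using Metric_space_axioms mtopology_eq straight_G_space by blast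
qed

end
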